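(* Consider a charged three-body system with masses $m_1,m_2,m_3>0$ and coupling constants $\alpha_1,\alpha_2,\alpha_3\in\mathbb{R}$. The critical points of the function $$\tilde{\mathcal Q}\times S^2_1\to\mathbb{R},\qquad (\tilde q,\tilde{\mathbf J})\mapsto\frac{\tilde V(\tilde q)}{2\sqrt{\tfrac12\,\tilde{\mathbf J}\cdot[\tilde{\mathbf M}(\tilde q)]^{-1}\cdot\tilde{\mathbf J}}}$$ are shape-orientation points of non-collinear relative equilibria.
   Context: Setting: three bodies with masses $m_1,m_2,m_3>0$ and positions $\mathbf x_1,\mathbf x_2,\mathbf x_3\in\mathbb{R}^3$, with Hamiltonian equal to kinetic energy plus the potential $$V=-\frac{\alpha_3}{r_{12}}-\frac{\alpha_2}{r_{13}}-\frac{\alpha_1}{r_{23}},\qquad r_{ij}=\|\mathbf x_i-\mathbf x_j\|,\quad \alpha_k\in\mathbb{R}.$$ Mass-weighted Jacobi vectors: $\mathbf s_1=\sqrt{\mu_1}(\mathbf x_1-\mathbf x_3)$, $\mathbf s_2=\sqrt{\mu_2}\big(\mathbf x_2-\frac{m_1\mathbf x_1+m_3\mathbf x_3}{m_1+m_3}\big)$ with $\mu_1=\frac{m_1m_3}{m_1+m_3}$, $\mu_2=\frac{m_2(m_1+m_3)}{m_1+m_2+m_3}$. Internal space: the internal space $\mathcal Q$ is the quotient of the space of pairs $(\mathbf s_1,\mathbf s_2)\in\mathbb{R}^3\times\mathbb{R}^3$ by the diagonal action of $\mathrm{SO}(3)$. Its interior $\mathcal Q^{\mathrm o}$ consists of the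 non-collinear configurations and has smooth (Jacobi) coordinates $q=(\rho_1,\rho_2,\phi)$ with $\rho_i=\|\mathbf s_i\|>0$, $\mathbf s_1\cdot\mathbf s_2=\rho_1\rho_2\cos\phi$, $0<\phi<\pi$. A body frame is fixed by representing $q$ by $\mathbf r_1=(\rho_1,0,0)$, $\mathbf r_2=(\rho_2\cos\phi,\rho_2\sin\phi,0)$. The potential, depending only on the mutual distances, is a function $V(q)$: $r_{13}=\rho_1/\sqrt{\mu_1}$, $r_{12}=\big\|\frac{\mathbf r_2}{\sqrt{\mu_2}}-\frac{m_3}{m_1+m_3}\frac{\mathbf r_1}{\sqrt{\mu_1}}\big\|$, $r_{23}=\big\|\frac{\mathbf r_2}{\sqrt{\mu_2}}+\frac{m_1}{m_1+m_3}\frac{\mathbf r_1}{\sqrt{\mu_1}}\big\|$. Reduced Hamiltonian: with $\mathbf J\in\mathbb{R}^3$ the body angular momentum (the angular momentum about the center of mass expressed in the body frame) and $p=(p_{\rho_1},p_{\rho_2},p_\phi)\in\mathbb{R}^3$ the momenta conjugate to $q$, $$H(q,p,\mathbf J)=\tfrac12\mathbf J\cdot\mathbf M^{-1}\cdot\mathbf J+\tfrac12 g^{\mu\nu}(p_\mu-\mathbf J\cdot\mathbf A_\mu)(p_\nu-\mathbf J\cdot\mathbf A_\nu)+V(q),$$ (summation over repeated indices), where $$\mathbf M(q)=\begin{pmatrix}\rho_2^2\sin^2\phi&-\rho_2^2\sin\phi\cos\phi&0\\-\rho_2^2\sin\phi\cos\phi&\rho_1^2+\rho_2^2\cos^2\phi&0\\0&0&\rho_1^2+\rho_2^2\end{pmatrix}$$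 is the moment of inertia tensor, $(g^{\mu\nu})$ is the inverse of $(g_{\mu\nu})=\mathrm{diag}\big(1,1,\frac{\rho_1^2\rho_2^2}{\rho_1^2+\rho_2^2}\big)$, $\mathbf A_{\rho_1}=\mathbf A_{\rho_2}=0$ and $\mathbf A_\phi=\big(0,0,\frac{\rho_2^2}{\rho_1^2+\rho_2^2}\big)$. Reduced equations of motion: $\dot q_\mu=\partial H/\partial p_\mu$, $\dot p_\mu=-\partial H/\partial q_\mu$, $\dot{\mathbf J}=\mathbf J\times\nabla_{\mathbf J}H$. A non-collinear relative equilibrium is a stationary solution $(q,p,\mathbf J)$, $q\in\mathcal Q^{\mathrm o}$, of these equations; equivalently $$\mathbf J\times(\mathbf M^{-1}\cdot\mathbf J)=0,\qquad p_\mu=\mathbf J\cdot\mathbf A_\mu,\qquad \frac{\partial}{\partial q_\mu}\Big(\tfrac12\mathbf J\cdot\mathbf M^{-1}(q)\cdot\mathbf J+V(q)\Big)=0$$ for $\mu=1,2,3$. Dilations, shapes and orientations: for $\lambda>0$, $d_\lambda(\rho_1,\rho_2,\phi)=(\lambda\rho_1,\lambda\rho_2,\phi)$. The shape space is the two-dimensional manifold $\tilde{\mathcal Q}=\{q\in\mathcal Q^{\mathrm o}: \rho_1^2+\rho_2^2=1\}$; its points $\tilde q$ are called shapes. $\tilde V$ and $\tilde{\mathbf M}$ denote the restrictions of $V$ and $\mathbf M$ to $\tilde{\mathcal Q}$. $S^2_1=\{\tilde{\mathbf J}\in\mathbb{R}^3:\|\tilde{\mathbf J}\|=1\}$ is the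 unit sphere of orientations. Points $(\tilde q,\tilde{\mathbf J})\in\tilde{\mathcal Q}\times S^2_1$ are called shape-orientation points; the shape-orientation point of $(q,p,\mathbf J)$ with $\mathbf J\ne0$ is $(\tilde q,\mathbf J/\|\mathbf J\|)$ where $\tilde q\in\tilde{\mathcal Q}$ is such that $q=d_\lambda(\tilde q)$ for some $\lambda>0$.
   Formalization: The formal theorem assumes that the potential Ṽ is negative at the critical point; without this the claim fails (e.g. all couplings zero, or three equal repelling charges), and Ṽ < 0 is necessary for a relative equilibrium with J ≠ 0. *)

theory Defs
  imports "HOL-Analysis.Analysis"
begin

(* Masses and couplings are vectors m, \<alpha> :: real^3 with components m $ i = m_i, \<alpha> $ i = \<alpha>_i.
   A point of the internal space is its vector of Jacobi coordinates
   q = (q $ 1, q $ 2, q $ 3) = (rho_1, rho_2, phi); the momenta p are indexed in the same way. *)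

definition internal_space_interior :: "(real^3) set" where
  "internal_space_interior = {q. 0 < q $ 1 \<and> 0 < q $ 2 \<and> 0 < q $ 3 \<and> q $ 3 < pi}"

definition red_mass1 :: "real^3 \<Rightarrow> real" where
  "red_mass1 m = m $ 1 * m $ 3 / (m $ 1 + m $ 3)"

definition red_mass2 :: "real^3 \<Rightarrow> real" where
  "red_mass2 m = m $ 2 * (m $ 1 + m $ 3) / (m $ 1 + m $ 2 + m $ 3)"

definition body_vec1 :: "real^3 \<Rightarrow> real^3" where
  "body_vec1 q = vector [q $ 1, 0, 0]"

definition body_vec2 :: "real^3 \<Rightarrow> real^3" where
  "body_vec2 q = vector [q $ 2 * cos (q $ 3), q $ 2 * sin (q $ 3), 0]"

definition dist12 :: "real^3 \<Rightarrow> real^3 \<Rightarrow> real" where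
  "dist12 m q = norm (body_vec2 q /\<^sub>R sqrt (red_mass2 m)
     - (m $ 3 / (m $ 1 + m $ 3)) *\<^sub>R (body_vec1 q /\<^sub>R sqrt (red_mass1 m)))"

definition dist13 :: "real^3 \<Rightarrow> real^3 \<Rightarrow> real" where
  "dist13 m q = q $ 1 / sqrt (red_mass1 m)"

definition dist23 :: "real^3 \<Rightarrow> real^3 \<Rightarrow> real" where
  "dist23 m q = norm (body_vec2 q /\<^sub>R sqrt (red_mass2 m)
     + (m $ 1 / (m $ 1 + m $ 3)) *\<^sub>R (body_vec1 q /\<^sub>R sqrt (red_mass1 m)))"

definition potential :: "real^3 \<Rightarrow> real^3 \<Rightarrow> real^3 \<Rightarrow> real" where
  "potential m \<alpha> q =
     - (\<alpha> $ 3 / dist12 m q) - \<alpha> $ 2 / dist13 m q - \<alpha> $ 1 / dist23 m q"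

definition inertia :: "real^3 \<Rightarrow> real^3^3" where
  "inertia q = vector
     [vector [(q $ 2)\<^sup>2 * (sin (q $ 3))\<^sup>2, - ((q $ 2)\<^sup>2 * sin (q $ 3) * cos (q $ 3)), 0],
      vector [- ((q $ 2)\<^sup>2 * sin (q $ 3) * cos (q $ 3)),
              (q $ 1)\<^sup>2 + (q $ 2)\<^sup>2 * (cos (q $ 3))\<^sup>2, 0],
      vector [0, 0, (q $ 1)\<^sup>2 + (q $ 2)\<^sup>2]]"

definition shape_metric :: "real^3 \<Rightarrow> real^3^3" where
  "shape_metric q = vector
     [vector [1, 0, 0],
      vector [0, 1, 0],
      vector [0, 0, (q $ 1)\<^sup>2 * (q $ 2)\<^sup>2 / ((q $ 1)\<^sup>2 + (q $ 2)\<^sup>2)]]"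

(* Row \<mu> of this matrix is the gauge potential vector A_\<mu>. *)
definition gauge_potential :: "real^3 \<Rightarrow> real^3^3" where
  "gauge_potential q = vector [0, 0, vector [0, 0, (q $ 2)\<^sup>2 / ((q $ 1)\<^sup>2 + (q $ 2)\<^sup>2)]]"

definition hamiltonian :: "real^3 \<Rightarrow> real^3 \<Rightarrow> real^3 \<Rightarrow> real^3 \<Rightarrow> real^3 \<Rightarrow> real" where
  "hamiltonian m \<alpha> q p J =
     1/2 * (J \<bullet> (matrix_inv (inertia q) *v J))
   + 1/2 * (\<Sum>\<mu>\<in>UNIV. \<Sum>\<nu>\<in>UNIV. matrix_inv (shape_metric q) $ \<mu> $ \<nu>
        * (p $ \<mu> - J \<bullet> gauge_potential q $ \<mu>) * (p $ \<nu> - J \<bullet> gauge_potential q $ \<nu>))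
   + potential m \<alpha> q"

definition gradient :: "(real^3 \<Rightarrow> real) \<Rightarrow> real^3 \<Rightarrow> real^3" where
  "gradient f x = (\<chi> i. deriv (\<lambda>t. f (x + t *\<^sub>R axis i 1)) 0)"

definition reduced_solution ::
  "real^3 \<Rightarrow> real^3 \<Rightarrow> (real \<Rightarrow> real^3) \<Rightarrow> (real \<Rightarrow> real^3) \<Rightarrow> (real \<Rightarrow> real^3) \<Rightarrow> bool" where
  "reduced_solution m \<alpha> q p J \<longleftrightarrow> (\<forall>t.
     q t \<in> internal_space_interior \<and>
     (q has_vector_derivative gradient (\<lambda>x. hamiltonian m \<alpha> (q t) x (J t)) (p t)) (at t) \<and>
     (p has_vector_derivative - gradient (\<lambda>x. hamiltonian m \<alpha> x (p t) (J t)) (q t)) (at t) \<and>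
     (J has_vector_derivative
        cross3 (J t) (gradient (\<lambda>x. hamiltonian m \<alpha> (q t) (p t) x) (J t))) (at t))"

definition noncollinear_relative_equilibrium ::
  "real^3 \<Rightarrow> real^3 \<Rightarrow> real^3 \<Rightarrow> real^3 \<Rightarrow> real^3 \<Rightarrow> bool" where
  "noncollinear_relative_equilibrium m \<alpha> q p J \<longleftrightarrow>
     reduced_solution m \<alpha> (\<lambda>_. q) (\<lambda>_. p) (\<lambda>_. J)"

definition dilation :: "real \<Rightarrow> real^3 \<Rightarrow> real^3" where
  "dilation c q = vector [c * q $ 1, c * q $ 2, q $ 3]"

definition shape_space :: "(real^3) set" where
  "shape_space = {q \<in> internal_space_interior. (q $ 1)\<^sup>2 + (q $ 2)\<^sup>2 = 1}"

definition orientation_sphere :: "(real^3) set" where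
  "orientation_sphere = sphere 0 1"

definition is_shape_orientation_of ::
  "(real^3) \<times> (real^3) \<Rightarrow> real^3 \<Rightarrow> real^3 \<Rightarrow> bool" where
  "is_shape_orientation_of z q J \<longleftrightarrow>
     J \<noteq> 0 \<and> fst z \<in> shape_space \<and> (\<exists>c>0. q = dilation c (fst z)) \<and> snd z = J /\<^sub>R norm J"

definition shape_orientation_function ::
  "real^3 \<Rightarrow> real^3 \<Rightarrow> (real^3) \<times> (real^3) \<Rightarrow> real" where
  "shape_orientation_function m \<alpha> = (\<lambda>(q, J).
     potential m \<alpha> q / (2 * sqrt (1/2 * (J \<bullet> (matrix_inv (inertia q) *v J)))))"

(* For an embedded submanifold N and f smooth on N: x is a critical point of f restricted to N.
   Tangent vectors of N at x are the velocities at 0 of curves c in N with c 0 = x, and the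
   differential of f at x sends such a velocity to the derivative of f \<circ> c at 0. *)
definition critical_point_on ::
  "'a::real_normed_vector set \<Rightarrow> ('a \<Rightarrow> real) \<Rightarrow> 'a \<Rightarrow> bool" where
  "critical_point_on N f x \<longleftrightarrow> x \<in> N \<and>
     (\<forall>c e. 0 < e \<and> c C1_differentiable_on {-e<..<e} \<and> c ` {-e<..<e} \<subseteq> N \<and> c 0 = x
        \<longrightarrow> ((\<lambda>t. f (c t)) has_real_derivative 0) (at 0))"

end

theory Submission
  imports Defs
begin

text \<open>
  Write \<open>T = J \<bullet> M\<inverse> J\<close>. Since \<open>V \<noteq> 0\<close> at the critical point, criticality says that
  \<open>2 T dV = V dT\<close> on tangent vectors. In the orientation directions this makes \<open>M\<inverse> J\<close> parallel
  to \<open>J\<close>; in the shape directions it says that \<open>\<mu>\<^sup>2 T / 2 + V\<close> is stationary for \<open>\<mu>\<^sup>2 = - V / T\<close>,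
  which is positive because \<open>V < 0\<close>. As \<open>T\<close> and \<open>V\<close> are homogeneous of degrees \<open>-2\<close> and \<open>-1\<close> under
  dilations, the same choice of \<open>\<mu>\<close> makes the dilation derivative \<open>- \<mu>\<^sup>2 T - V\<close> vanish. So the shape
  itself, with \<open>J\<close> scaled by \<open>\<mu>\<close>, is a relative equilibrium.
\<close>

section \<open>The inverse inertia tensor and its quadratic form\<close>

definition inertia_inv :: "real^3 \<Rightarrow> real^3^3" where
  "inertia_inv q = vector
     [vector [1 / ((q $ 2)\<^sup>2 * (sin (q $ 3))\<^sup>2) + (cos (q $ 3))\<^sup>2 / ((q $ 1)\<^sup>2 * (sin (q $ 3))\<^sup>2),
              cos (q $ 3) / ((q $ 1)\<^sup>2 * sin (q $ 3)), 0],
      vector [cos (q $ 3) / ((q $ 1)\<^sup>2 * sin (q $ 3)), 1 / (q $ 1)\<^sup>2, 0],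
      vector [0, 0, 1 / ((q $ 1)\<^sup>2 + (q $ 2)\<^sup>2)]]"

text \<open>The form defined by \<open>inertia_inv q\<close> with squares completed, so that definiteness is visible.\<close>

definition inertia_form :: "real^3 \<Rightarrow> real^3 \<Rightarrow> real" where
  "inertia_form q J = (J $ 1)\<^sup>2 / ((q $ 2)\<^sup>2 * (sin (q $ 3))\<^sup>2)
     + (cos (q $ 3) * J $ 1 / sin (q $ 3) + J $ 2)\<^sup>2 / (q $ 1)\<^sup>2
     + (J $ 3)\<^sup>2 / ((q $ 1)\<^sup>2 + (q $ 2)\<^sup>2)"

lemma internal_space_interiorD:
  assumes "q \<in> internal_space_interior"
  shows "0 < q $ 1" "0 < q $ 2" "0 < sin (q $ 3)" "0 < (q $ 1)\<^sup>2 + (q $ 2)\<^sup>2"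
  using assms by (auto simp: internal_space_interior_def sin_gt_zero add_pos_pos)

lemma open_internal_space_interior: "open internal_space_interior"
  unfolding internal_space_interior_def
  by (intro open_Collect_conj open_Collect_less continuous_intros)

text \<open>\<open>matrix_inv\<close> is a choice among two-sided inverses. A right inverse of a
  square matrix is two-sided, so such an inverse exists, and associativity forces the chosen one to
  be \<open>B\<close>.\<close>

lemma matrix_inv_eqI:
  fixes A B :: "real^'n^'n"
  assumes "A ** B = mat 1"
  shows "matrix_inv A = B"
proof -
  have "\<exists>B. A ** B = mat 1 \<and> B ** A = mat 1"
    using assms matrix_left_right_inverse[of A B] by auto
  from someI_ex[OF this] have "matrix_inv A ** A = mat 1"
    unfolding matrix_inv_def by (rule conjunct2)
  then have "matrix_inv A ** (A ** B) = B"
    unfolding matrix_mul_assoc by (simp only: matrix_mul_lid)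
  then show ?thesis by (simp add: assms)
qed

lemma block_matrix_mult_eq_mat_1:
  fixes a b d e a' b' d' e' :: real
  assumes "a * a' + b * b' = 1" "a * b' + b * d' = 0" "b * a' + d * b' = 0" "b * b' + d * d' = 1"
    "e * e' = 1"
  shows "(vector [vector [a, b, 0], vector [b, d, 0], vector [0, 0, e]] :: real^3^3)
     ** vector [vector [a', b', 0], vector [b', d', 0], vector [0, 0, e']] = mat 1"
  by (simp add: matrix_matrix_mult_def mat_def vec_eq_iff forall_3 sum_3) (use assms in blast)

lemma matrix_inv_inertia:
  assumes "q \<in> internal_space_interior"
  shows "matrix_inv (inertia q) = inertia_inv q"
proof (rule matrix_inv_eqI)
  note pos = internal_space_interiorD[OF assms]
  \<comment> \<open>With sine and cosine abstracted, rational identities with nonzero denominators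
    remain.\<close>
  define x y s c where "x = q $ 1" and "y = q $ 2" and "s = sin (q $ 3)" and "c = cos (q $ 3)"
  have ne: "x \<noteq> 0" "y \<noteq> 0" "s \<noteq> 0" "x\<^sup>2 + y\<^sup>2 \<noteq> 0"
    using pos by (auto simp: x_def y_def s_def)
  have "y\<^sup>2 * s\<^sup>2 * (1 / (y\<^sup>2 * s\<^sup>2) + c\<^sup>2 / (x\<^sup>2 * s\<^sup>2)) + - (y\<^sup>2 * s * c) * (c / (x\<^sup>2 * s)) = 1"
    using ne(1-3) by (simp add: field_simps power2_eq_square)
  moreover have "y\<^sup>2 * s\<^sup>2 * (c / (x\<^sup>2 * s)) + - (y\<^sup>2 * s * c) * (1 / x\<^sup>2) = 0"
    using ne(1-3) by (simp add: field_simps power2_eq_square)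
  moreover have "- (y\<^sup>2 * s * c) * (1 / (y\<^sup>2 * s\<^sup>2) + c\<^sup>2 / (x\<^sup>2 * s\<^sup>2))
      + (x\<^sup>2 + y\<^sup>2 * c\<^sup>2) * (c / (x\<^sup>2 * s)) = 0"
    using ne(1-3) by (simp add: divide_simps) (simp add: power2_eq_square algebra_simps)
  moreover have "- (y\<^sup>2 * s * c) * (c / (x\<^sup>2 * s)) + (x\<^sup>2 + y\<^sup>2 * c\<^sup>2) * (1 / x\<^sup>2) = 1"
    using ne(1-3) by (simp add: divide_simps) (simp add: power2_eq_square)
  moreover have "(x\<^sup>2 + y\<^sup>2) * (1 / (x\<^sup>2 + y\<^sup>2)) = 1" using ne(4) by simp
  ultimately show "inertia q ** inertia_inv q = mat 1"
    unfolding inertia_def inertia_inv_def x_def y_def s_def c_def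
    by (rule block_matrix_mult_eq_mat_1)
qed

lemma matrix_inv_shape_metric:
  assumes "q \<in> internal_space_interior"
  shows "matrix_inv (shape_metric q) = vector [vector [1, 0, 0], vector [0, 1, 0],
     vector [0, 0, ((q $ 1)\<^sup>2 + (q $ 2)\<^sup>2) / ((q $ 1)\<^sup>2 * (q $ 2)\<^sup>2)]]"
proof (rule matrix_inv_eqI)
  note pos = internal_space_interiorD[OF assms]
  show "shape_metric q ** vector [vector [1, 0, 0], vector [0, 1, 0],
     vector [0, 0, ((q $ 1)\<^sup>2 + (q $ 2)\<^sup>2) / ((q $ 1)\<^sup>2 * (q $ 2)\<^sup>2)]] = mat 1"
    unfolding shape_metric_def by (rule block_matrix_mult_eq_mat_1) (use pos in simp_all)
qed

lemma inertia_form_eq: "inertia_form q J = J \<bullet> (inertia_inv q *v J)"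
  by (simp add: inertia_form_def inertia_inv_def inner_vec_def matrix_vector_mult_def sum_3
      divide_inverse algebra_simps power2_eq_square)

text \<open>Every summand is a square over a positive quantity. If all vanish, the first and third
  give \<open>J $ 1 = 0\<close> and \<open>J $ 3 = 0\<close>, and then the second gives
  \<open>J $ 2 = 0\<close>.\<close>

lemma inertia_form_pos:
  assumes "q \<in> internal_space_interior" "J \<noteq> 0"
  shows "0 < inertia_form q J"
proof -
  note pos = internal_space_interiorD[OF assms(1)]
  have "inertia_form q J \<ge> 0"
    unfolding inertia_form_def by (intro add_nonneg_nonneg divide_nonneg_nonneg) auto
  moreover have "inertia_form q J \<noteq> 0"
  proof
    assume *: "inertia_form q J = 0"
    have "J $ 1 = 0 \<and> J $ 2 = 0 \<and> J $ 3 = 0"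
      using * pos unfolding inertia_form_def
      by (auto simp: add_nonneg_eq_0_iff)
    with assms(2) show False by (simp add: vec_eq_iff forall_3)
  qed
  ultimately show ?thesis by simp
qed

lemma inertia_form_scaleR: "inertia_form q (c *\<^sub>R J) = c\<^sup>2 * inertia_form q J"
  by (simp add: inertia_form_def field_simps power2_eq_square)

text \<open>Each denominator carries the factor \<open>c\<^sup>2\<close> once. At
  \<open>c = 0\<close> both sides are zero, since division by zero yields zero.\<close>

lemma inertia_form_dilation: "inertia_form (dilation c q) J = inertia_form q J / c\<^sup>2"
proof -
  have "(c * q $ 1)\<^sup>2 + (c * q $ 2)\<^sup>2 = c\<^sup>2 * ((q $ 1)\<^sup>2 + (q $ 2)\<^sup>2)"
    by (simp add: power_mult_distrib distrib_left)
  then show ?thesis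
    unfolding inertia_form_def dilation_def
    by (simp add: add_divide_distrib power_mult_distrib mult_ac)
qed

lemma inertia_inv_symmetric: "x \<bullet> (inertia_inv q *v y) = y \<bullet> (inertia_inv q *v x)"
  by (simp add: inertia_inv_def inner_vec_def matrix_vector_mult_def sum_3 algebra_simps)

section \<open>Homogeneity and differentiability of the potential\<close>

lemma potential_dilation:
  assumes "0 < c"
  shows "potential m \<alpha> (dilation c q) = potential m \<alpha> q / c"
proof -
  \<comment> \<open>At a fixed angle the body vectors are linear in the two lengths, so all mutual
    distances scale by \<open>c\<close>.\<close>
  have b: "body_vec1 (dilation c q) = c *\<^sub>R body_vec1 q" "body_vec2 (dilation c q) = c *\<^sub>R body_vec2 q"
    by (simp_all add: body_vec1_def body_vec2_def dilation_def vec_eq_iff forall_3)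
  have "dist12 m (dilation c q) = norm (c *\<^sub>R (body_vec2 q /\<^sub>R sqrt (red_mass2 m)
     - (m $ 3 / (m $ 1 + m $ 3)) *\<^sub>R (body_vec1 q /\<^sub>R sqrt (red_mass1 m))))"
    unfolding dist12_def b by (simp add: scaleR_diff_right mult_ac)
  then have "dist12 m (dilation c q) = c * dist12 m q"
    using assms by (simp add: dist12_def)
  moreover have "dist23 m (dilation c q) = norm (c *\<^sub>R (body_vec2 q /\<^sub>R sqrt (red_mass2 m)
     + (m $ 1 / (m $ 1 + m $ 3)) *\<^sub>R (body_vec1 q /\<^sub>R sqrt (red_mass1 m))))"
    unfolding dist23_def b by (simp add: scaleR_add_right mult_ac)
  then have "dist23 m (dilation c q) = c * dist23 m q"
    using assms by (simp add: dist23_def)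
  moreover have "dist13 m (dilation c q) = c * dist13 m q"
    by (simp add: dist13_def dilation_def)
  ultimately show ?thesis
    by (simp add: potential_def diff_divide_distrib mult.commute)
qed

lemma vec_nth_has_derivative [derivative_intros]:
  "(f has_derivative D) F \<Longrightarrow> ((\<lambda>x. f x $ i) has_derivative (\<lambda>h. D h $ i)) F"
  by (rule bounded_linear.has_derivative[OF bounded_linear_vec_nth])

lemma differentiable_body_vec:
  "body_vec1 differentiable (at q)" "body_vec2 differentiable (at q)"
proof -
  have 1: "body_vec1 = (\<lambda>q. (q $ 1) *\<^sub>R axis 1 1)"
    by (auto simp: body_vec1_def vec_eq_iff forall_3 axis_def)
  have 2: "body_vec2 = (\<lambda>q. (q $ 2 * cos (q $ 3)) *\<^sub>R axis 1 1 + (q $ 2 * sin (q $ 3)) *\<^sub>R axis 2 1)"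
    by (auto simp: body_vec2_def vec_eq_iff forall_3 axis_def)
  show "body_vec1 differentiable (at q)" "body_vec2 differentiable (at q)"
    unfolding 1 2 differentiable_def by (rule exI, (rule derivative_intros)+)+
qed

lemma differentiable_potential:
  assumes m: "\<forall>i. 0 < m $ i" and q: "q \<in> internal_space_interior"
  shows "potential m \<alpha> differentiable (at q)"
proof -
  note pos = internal_space_interiorD[OF q]
  have mu: "0 < red_mass1 m" "0 < red_mass2 m"
    using m by (simp_all add: red_mass1_def red_mass2_def add_pos_pos)
  \<comment> \<open>Non-collinearity excludes collisions: \<open>body_vec1 q\<close> lies on the
    first axis, so the second component is a positive multiple of \<open>q $ 2 * sin (q $ 3)\<close>
    for every \<open>c\<close>. Hence the norms are differentiable and can be inverted.\<close>
  have ne: "body_vec2 q /\<^sub>R sqrt (red_mass2 m) + c *\<^sub>R (body_vec1 q /\<^sub>R sqrt (red_mass1 m)) \<noteq> 0" for c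
  proof
    assume "body_vec2 q /\<^sub>R sqrt (red_mass2 m) + c *\<^sub>R (body_vec1 q /\<^sub>R sqrt (red_mass1 m)) = 0"
    from arg_cong[OF this, where f="\<lambda>v. v $ 2"] show False
      using pos mu by (simp add: body_vec1_def body_vec2_def)
  qed
  have d: "(\<lambda>q. norm (body_vec2 q /\<^sub>R sqrt (red_mass2 m) + c *\<^sub>R (body_vec1 q /\<^sub>R sqrt (red_mass1 m))))
      differentiable (at q)" for c
    by (rule differentiable_compose[where f=norm], rule differentiable_norm_at, rule ne)
      (intro derivative_intros differentiable_body_vec)
  have eq12: "dist12 m = (\<lambda>q. norm (body_vec2 q /\<^sub>R sqrt (red_mass2 m)
     + (- (m $ 3 / (m $ 1 + m $ 3))) *\<^sub>R (body_vec1 q /\<^sub>R sqrt (red_mass1 m))))"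
    by (auto simp: dist12_def)
  have eq23: "dist23 m = (\<lambda>q. norm (body_vec2 q /\<^sub>R sqrt (red_mass2 m)
     + (m $ 1 / (m $ 1 + m $ 3)) *\<^sub>R (body_vec1 q /\<^sub>R sqrt (red_mass1 m))))"
    by (auto simp: dist23_def)
  have "dist12 m differentiable (at q)" "dist23 m differentiable (at q)"
    unfolding eq12 eq23 by (rule d)+
  moreover have "dist12 m q \<noteq> 0" "dist23 m q \<noteq> 0"
    unfolding eq12 eq23 norm_eq_zero by (rule ne)+
  moreover have "dist13 m differentiable (at q)"
    unfolding dist13_def[abs_def] divide_inverse
    by (intro derivative_intros bounded_linear_imp_differentiable bounded_linear_vec_nth)
  moreover have "dist13 m q \<noteq> 0"
    using pos mu by (simp add: dist13_def)
  ultimately show ?thesis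
    unfolding potential_def[abs_def] divide_inverse
    by (intro derivative_intros)
qed

text \<open>Joint differentiability lets one derivative serve both shape and orientation
  directions.\<close>

lemma differentiable_inertia_form:
  assumes "q \<in> internal_space_interior"
  shows "(\<lambda>z. inertia_form (fst z) (snd z)) differentiable (at (q, J))"
  using internal_space_interiorD[OF assms]
  unfolding inertia_form_def[abs_def] differentiable_def
  by - (rule exI, (rule derivative_intros | simp)+)

section \<open>The Hamiltonian in coordinates and tools for its gradients\<close>

lemma hamiltonian_eq:
  assumes "q \<in> internal_space_interior"
  shows "hamiltonian m \<alpha> q p J = 1/2 * inertia_form q J
     + 1/2 * ((p $ 1)\<^sup>2 + (p $ 2)\<^sup>2
       + ((q $ 1)\<^sup>2 + (q $ 2)\<^sup>2) / ((q $ 1)\<^sup>2 * (q $ 2)\<^sup>2)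
         * (p $ 3 - J $ 3 * ((q $ 2)\<^sup>2 / ((q $ 1)\<^sup>2 + (q $ 2)\<^sup>2)))\<^sup>2)
     + potential m \<alpha> q"
  unfolding hamiltonian_def inertia_form_eq matrix_inv_inertia[OF assms] matrix_inv_shape_metric[OF assms]
  by (simp add: sum_3 gauge_potential_def inner_vec_def power2_eq_square mult_ac)

text \<open>The chain rule along the coordinate lines converts a total derivative into the partial
  derivatives that define \<open>gradient\<close>.\<close>

lemma gradient_eq:
  assumes "(f has_derivative D) (at x)"
  shows "gradient f x = (\<chi> i. D (axis i 1))"
proof -
  have "deriv (\<lambda>t. f (x + t *\<^sub>R axis i 1)) 0 = D (axis i 1)" for i
  proof (rule DERIV_imp_deriv)
    have "((\<lambda>t::real. x + t *\<^sub>R axis i 1) has_derivative (\<lambda>t. t *\<^sub>R axis i 1)) (at 0)"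
      by (auto intro!: derivative_eq_intros)
    from has_derivative_compose[OF this, of f D] assms
    have "((\<lambda>t. f (x + t *\<^sub>R axis i 1)) has_derivative (\<lambda>t. D (t *\<^sub>R axis i 1))) (at 0)"
      by simp
    moreover have "(\<lambda>t. D (t *\<^sub>R axis i 1)) = (*) (D (axis i 1))"
      using has_derivative_linear[OF assms] by (auto simp: linear_scale)
    ultimately show "((\<lambda>t. f (x + t *\<^sub>R axis i 1)) has_real_derivative D (axis i 1)) (at 0)"
      by (simp add: has_field_derivative_def)
  qed
  then show ?thesis by (simp add: gradient_def)
qed

text \<open>By the product rule every term keeps a factor \<open>u x\<close>. This removes the
  kinetic terms, which vanish to second order at an equilibrium, without differentiating the metric
  or the gauge potential explicitly.\<close>

lemma has_derivative_mult_square_zero: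
  fixes g u :: "'a::real_normed_vector \<Rightarrow> real"
  assumes "g differentiable (at x)" "u differentiable (at x)" "u x = 0"
  shows "((\<lambda>x. g x * (u x)\<^sup>2) has_derivative (\<lambda>_. 0)) (at x)"
proof -
  obtain G U where "(g has_derivative G) (at x)" "(u has_derivative U) (at x)"
    using assms(1,2) by (auto simp: differentiable_def)
  then show ?thesis
    by (auto intro!: derivative_eq_intros simp: assms(3))
qed

section \<open>Test curves and criticality along them\<close>

lemma trig_curve_C1:
  fixes a b d e :: "'a::real_normed_vector"
  shows "(\<lambda>t. cos t *\<^sub>R a + sin t *\<^sub>R b + t *\<^sub>R d + e) C1_differentiable_on S"
  unfolding C1_differentiable_on_def
  by (intro exI[of _ "\<lambda>t. - sin t *\<^sub>R a + cos t *\<^sub>R b + d"] conjI ballI)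
    (auto intro!: derivative_eq_intros continuous_intros)

lemma trig_curve_has_derivative:
  fixes a b d e :: "'a::real_normed_vector"
  shows "((\<lambda>t. cos t *\<^sub>R a + sin t *\<^sub>R b + t *\<^sub>R d + e) has_derivative (\<lambda>t. t *\<^sub>R (b + d))) (at 0)"
  by (auto intro!: derivative_eq_intros simp: scaleR_add_right)

text \<open>With \<open>r = sqrt (1/2 * k x)\<close> the numerator of the quotient rule is
  \<open>2 * r * f' - f x * k' / (2 * r)\<close>. Setting it to zero and using
  \<open>k x = 2 * r\<^sup>2\<close> gives the claim.\<close>

lemma critical_quotient:
  fixes f k :: "real \<Rightarrow> real"
  assumes f: "(f has_real_derivative f') (at x)" and k: "(k has_real_derivative k') (at x)"
    and pos: "0 < k x"
    and crit: "((\<lambda>t. f t / (2 * sqrt (1/2 * k t))) has_real_derivative 0) (at x)"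
  shows "2 * k x * f' = f x * k'"
proof -
  define r where "r = sqrt (1/2 * k x)"
  have r: "0 < r" "k x = 2 * r\<^sup>2" using pos by (simp_all add: r_def)
  have "((\<lambda>t. f t / (2 * sqrt (1/2 * k t))) has_real_derivative
       (f' * (2 * r) - f x * (2 * (inverse r / 2 * (1/2 * k')))) / (2 * r)\<^sup>2) (at x)"
    using f k pos
    by (auto intro!: derivative_eq_intros simp: r_def power2_eq_square)
  from DERIV_unique[OF this crit] r(1) have "f' * (2 * r) = f x * (2 * (inverse r / 2 * (1/2 * k')))"
    by simp
  then show ?thesis unfolding r(2) using r(1) by (simp add: field_simps power2_eq_square)
qed

text \<open>One family of curves covers all tangent directions used later: the trigonometric part
  gives great circles of orientations and arcs of the circle of lengths, the linear part moves the
  angle. The velocity at 0 is \<open>b + d\<close>, and only small times have to stay in the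
  manifold.\<close>

lemma critical_direction:
  assumes crit: "critical_point_on (shape_space \<times> orientation_sphere)
                     (shape_orientation_function m \<alpha>) (q, J)"
    and DV: "(potential m \<alpha> has_derivative DV) (at q)"
    and DT: "((\<lambda>z. inertia_form (fst z) (snd z)) has_derivative DT) (at (q, J))"
    and start: "a + e = (q, J)"
    and ev: "eventually (\<lambda>t. cos t *\<^sub>R a + sin t *\<^sub>R b + t *\<^sub>R d + e
               \<in> shape_space \<times> orientation_sphere) (nhds 0)"
  shows "2 * inertia_form q J * DV (fst (b + d)) = potential m \<alpha> q * DT (b + d)"
proof -
  define c where "c = (\<lambda>t::real. cos t *\<^sub>R a + sin t *\<^sub>R b + t *\<^sub>R d + e)"
  have c0: "c 0 = (q, J)" using start by (simp add: c_def)
  obtain \<epsilon> where \<epsilon>: "0 < \<epsilon>" "\<And>t. dist t 0 < \<epsilon> \<Longrightarrow> c t \<in> shape_space \<times> orientation_sphere"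
    using ev unfolding eventually_nhds_metric c_def by blast
  have sub: "c ` {-\<epsilon><..<\<epsilon>} \<subseteq> shape_space \<times> orientation_sphere"
    using \<epsilon>(2) by (intro image_subsetI) (simp add: dist_real_def abs_less_iff)
  have C1: "c C1_differentiable_on {-\<epsilon><..<\<epsilon>}"
    unfolding c_def by (rule trig_curve_C1)
  have cd: "(c has_derivative (\<lambda>t. t *\<^sub>R (b + d))) (at 0)"
    unfolding c_def by (rule trig_curve_has_derivative)
  have qJ: "(q, J) \<in> shape_space \<times> orientation_sphere"
    using crit by (simp add: critical_point_on_def)
  have "((\<lambda>t. shape_orientation_function m \<alpha> (c t)) has_real_derivative 0) (at 0)"
    using crit \<epsilon>(1) C1 sub c0 unfolding critical_point_on_def by blast
  \<comment> \<open>The closed form of the inverse holds in the interior, so the two functions agree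
    on a whole neighbourhood of 0, as a derivative requires.\<close>
  moreover have "shape_orientation_function m \<alpha> (c t)
      = potential m \<alpha> (fst (c t)) / (2 * sqrt (1/2 * inertia_form (fst (c t)) (snd (c t))))"
    if "t \<in> {-\<epsilon><..<\<epsilon>}" for t
  proof -
    have "fst (c t) \<in> internal_space_interior"
      using sub that by (auto simp: shape_space_def image_subset_iff mem_Times_iff)
    from matrix_inv_inertia[OF this] show ?thesis
      by (simp add: shape_orientation_function_def split_beta inertia_form_eq)
  qed
  ultimately have quot: "((\<lambda>t. potential m \<alpha> (fst (c t))
       / (2 * sqrt (1/2 * inertia_form (fst (c t)) (snd (c t))))) has_real_derivative 0) (at 0)"
    using \<epsilon>(1) by (elim has_field_derivative_transform_within_open[where S="{-\<epsilon><..<\<epsilon>}"]) auto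
  have "((\<lambda>t. potential m \<alpha> (fst (c t))) has_derivative (\<lambda>t. DV (fst (t *\<^sub>R (b + d))))) (at 0)"
    by (rule has_derivative_compose[OF has_derivative_fst[OF cd]]) (simp add: c0 DV)
  then have fd: "((\<lambda>t. potential m \<alpha> (fst (c t))) has_real_derivative DV (fst (b + d))) (at 0)"
    using linear_scale[OF has_derivative_linear[OF DV]]
    by (simp add: has_field_derivative_def mult_commute_abs fst_scaleR)
  have "((\<lambda>t. inertia_form (fst (c t)) (snd (c t))) has_derivative (\<lambda>t. DT (t *\<^sub>R (b + d)))) (at 0)"
    by (rule has_derivative_compose[OF cd, of "\<lambda>z. inertia_form (fst z) (snd z)"]) (simp add: c0 DT)
  then have kd: "((\<lambda>t. inertia_form (fst (c t)) (snd (c t))) has_real_derivative DT (b + d)) (at 0)"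
    using linear_scale[OF has_derivative_linear[OF DT]]
    by (simp add: has_field_derivative_def mult_commute_abs)
  have "0 < inertia_form q J"
    using qJ by (intro inertia_form_pos) (auto simp: shape_space_def orientation_sphere_def)
  with critical_quotient[OF fd kd _ quot] show ?thesis
    by (simp add: c0)
qed

section \<open>From a stationary effective potential to a relative equilibrium\<close>

lemma inertia_form_has_derivative:
  "(inertia_form q has_derivative (\<lambda>h. 2 * (h \<bullet> (inertia_inv q *v J)))) (at J)"
proof -
  have "inertia_form q = (\<lambda>J. J \<bullet> (inertia_inv q *v J))"
    by (rule ext) (rule inertia_form_eq)
  moreover have "((\<lambda>J. J \<bullet> (inertia_inv q *v J)) has_derivative
      (\<lambda>h. J \<bullet> (inertia_inv q *v h) + h \<bullet> (inertia_inv q *v J))) (at J)"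
    by (intro derivative_intros bounded_linear.has_derivative[OF matrix_vector_mul_bounded_linear])
  ultimately show ?thesis
    by (simp add: inertia_inv_symmetric[of J])
qed

text \<open>The momentum is p_\<mu> = J \<bullet> A_\<mu>, where only the third component of
  A_\<phi> is nonzero. The kinetic squares then vanish to second order, so the gradients in
  \<open>q\<close> and \<open>J\<close> come from the effective potential alone and the one in
  \<open>p\<close> is zero.\<close>

lemma relative_equilibriumI:
  fixes q J p :: "real^3"
  defines "p \<equiv> vector [0, 0, J $ 3 * ((q $ 2)\<^sup>2 / ((q $ 1)\<^sup>2 + (q $ 2)\<^sup>2))]"
  assumes q: "q \<in> internal_space_interior"
    and cross: "cross3 J (inertia_inv q *v J) = 0"
    and crit: "((\<lambda>x. 1/2 * inertia_form x J + potential m \<alpha> x) has_derivative (\<lambda>_. 0)) (at q)"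
  shows "noncollinear_relative_equilibrium m \<alpha> q p J"
proof -
  note pos = internal_space_interiorD[OF q]
  \<comment> \<open>\<open>g\<close> is the angular entry of the inverse metric, \<open>A\<close>
    the third component of A_\<phi>.\<close>
  define g where "g = (\<lambda>x::real^3. ((x $ 1)\<^sup>2 + (x $ 2)\<^sup>2) / ((x $ 1)\<^sup>2 * (x $ 2)\<^sup>2))"
  define A where "A = (\<lambda>x::real^3. (x $ 2)\<^sup>2 / ((x $ 1)\<^sup>2 + (x $ 2)\<^sup>2))"
  have p: "p $ 1 = 0" "p $ 2 = 0" "p $ 3 = J $ 3 * A q"
    by (simp_all add: p_def A_def)
  \<comment> \<open>The factors \<open>1\<close> bring every momentum square into the shape
    \<open>g x * (u x)\<^sup>2\<close> of the vanishing lemma.\<close>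
  have H: "hamiltonian m \<alpha> x y K = 1/2 * inertia_form x K
       + 1/2 * (1 * (y $ 1)\<^sup>2 + 1 * (y $ 2)\<^sup>2 + g x * (y $ 3 - K $ 3 * A x)\<^sup>2) + potential m \<alpha> x"
    if "x \<in> internal_space_interior" for x y K
    using hamiltonian_eq[OF that] by (simp add: g_def A_def)
  have nth: "(\<lambda>x::real^3. x $ i) differentiable (at y)" for i y
    by (intro bounded_linear_imp_differentiable bounded_linear_vec_nth)
  have gA: "g differentiable (at q)" "A differentiable (at q)"
    unfolding g_def A_def using pos
    by (intro derivative_intros nth; simp)+
  have "((\<lambda>y. hamiltonian m \<alpha> q y J) has_derivative (\<lambda>_. 1/2 * (0 + 0 + 0))) (at p)"
    unfolding H[OF q] add.commute[of "1/2 * inertia_form q J"] add.assoc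
      has_derivative_add_const
    by (intro has_derivative_add_const has_derivative_mult_right has_derivative_add
        has_derivative_mult_square_zero derivative_intros nth) (simp_all add: p)
  from gradient_eq[OF this] have gp: "gradient (\<lambda>y. hamiltonian m \<alpha> q y J) p = 0"
    by (simp add: vec_eq_iff)
  have "((\<lambda>x. g x * (p $ 3 - J $ 3 * A x)\<^sup>2) has_derivative (\<lambda>_. 0)) (at q)"
    by (intro has_derivative_mult_square_zero gA derivative_intros) (simp add: p)
  from has_derivative_add[OF crit has_derivative_mult_right[OF this, of "1/2"]]
  have "((\<lambda>x. 1/2 * inertia_form x J + potential m \<alpha> x
      + 1/2 * (g x * (p $ 3 - J $ 3 * A x)\<^sup>2)) has_derivative (\<lambda>_. 0)) (at q)"
    by simp
  then have "((\<lambda>x. hamiltonian m \<alpha> x p J) has_derivative (\<lambda>_. 0)) (at q)"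
    by (rule has_derivative_transform_within_open[OF _ open_internal_space_interior q])
      (simp add: H p)
  from gradient_eq[OF this] have gq: "gradient (\<lambda>x. hamiltonian m \<alpha> x p J) q = 0"
    by (simp add: vec_eq_iff)
  have "((\<lambda>K. g q * (p $ 3 - K $ 3 * A q)\<^sup>2) has_derivative (\<lambda>_. 0)) (at J)"
    by (intro has_derivative_mult_square_zero derivative_intros nth) (simp add: p)
  from has_derivative_add[OF has_derivative_mult_right[OF inertia_form_has_derivative, of "1/2"]
      has_derivative_mult_right[OF this, of "1/2"]]
  have "((\<lambda>K. 1/2 * inertia_form q K + 1/2 * (g q * (p $ 3 - K $ 3 * A q)\<^sup>2)) has_derivative
      (\<lambda>h. h \<bullet> (inertia_inv q *v J))) (at J)"
    by simp
  then have "((\<lambda>K. hamiltonian m \<alpha> q p K) has_derivative (\<lambda>h. h \<bullet> (inertia_inv q *v J))) (at J)"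
    unfolding H[OF q] by (simp add: p has_derivative_add_const)
  from gradient_eq[OF this] have gJ: "gradient (\<lambda>K. hamiltonian m \<alpha> q p K) J = inertia_inv q *v J"
    by (simp add: vec_eq_iff inner_axis')
  show ?thesis
    unfolding noncollinear_relative_equilibrium_def reduced_solution_def
    by (simp add: q gp gq gJ cross)
qed

section \<open>Orientation, angle, circle and dilation directions at a critical point\<close>

theorem theorem6p1:
  fixes m \<alpha> qs Js :: "real^3"
  assumes masses: "\<forall>i. 0 < m $ i"
    and critical: "critical_point_on (shape_space \<times> orientation_sphere)
                     (shape_orientation_function m \<alpha>) (qs, Js)"
    and attractive: "potential m \<alpha> qs < 0"
  shows "\<exists>q p J. noncollinear_relative_equilibrium m \<alpha> q p J
                 \<and> is_shape_orientation_of (qs, Js) q J"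
proof -
  have qs: "qs \<in> shape_space" and Js: "norm Js = 1"
    using critical by (auto simp: critical_point_on_def orientation_sphere_def)
  have qi: "qs \<in> internal_space_interior" and one: "(qs $ 1)\<^sup>2 + (qs $ 2)\<^sup>2 = 1"
    using qs by (auto simp: shape_space_def)
  note pos = internal_space_interiorD[OF qi]
  define V T where "V = potential m \<alpha> qs" and "T = inertia_form qs Js"
  have T: "0 < T" unfolding T_def using Js by (intro inertia_form_pos qi) auto
  have V: "V < 0" using attractive by (simp add: V_def)
  obtain DV where DV: "(potential m \<alpha> has_derivative DV) (at qs)"
    using differentiable_potential[OF masses qi] by (auto simp: differentiable_def)
  obtain DT where DT: "((\<lambda>z. inertia_form (fst z) (snd z)) has_derivative DT) (at (qs, Js))"
    using differentiable_inertia_form[OF qi] by (auto simp: differentiable_def)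
  \<comment> \<open>Freezing one factor splits \<open>DT\<close> into a shape part and an
    orientation part; uniqueness of derivatives makes the latter explicit.\<close>
  have Tq: "((\<lambda>x. inertia_form x Js) has_derivative (\<lambda>v. DT (v, 0))) (at qs)"
    using has_derivative_compose[of "\<lambda>x. (x, Js)" "\<lambda>v. (v, 0)" qs UNIV, OF _ DT]
    by (simp add: has_derivative_Pair)
  have "((\<lambda>x. inertia_form qs x) has_derivative (\<lambda>v. DT (0, v))) (at Js)"
    using has_derivative_compose[of "\<lambda>x. (qs, x)" "\<lambda>v. (0, v)" Js UNIV, OF _ DT]
    by (simp add: has_derivative_Pair)
  from has_derivative_unique[OF this inertia_form_has_derivative]
  have TJ: "DT (0, v) = 2 * (v \<bullet> (inertia_inv qs *v Js))" for v by metis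

  note direction = critical_direction[OF critical DV DT, folded V_def T_def]

  \<comment> \<open>The test curve is the great circle through \<open>Js\<close> with velocity
    \<open>v\<close>. The shape is fixed, so the \<open>DV\<close> side is zero, and
    \<open>V\<close> is nonzero.\<close>
  have orth: "v \<bullet> (inertia_inv qs *v Js) = 0" if v: "norm v = 1" "v \<bullet> Js = 0" for v
  proof -
    have "norm (cos t *\<^sub>R Js + sin t *\<^sub>R v) = 1" for t
    proof -
      have "(norm (cos t *\<^sub>R Js + sin t *\<^sub>R v))\<^sup>2 = (cos t)\<^sup>2 * (norm Js)\<^sup>2 + (sin t)\<^sup>2 * (norm v)\<^sup>2"
        unfolding power2_norm_eq_inner using v(2)
        by (simp add: inner_add_left inner_add_right inner_commute power2_eq_square)
      then have "(norm (cos t *\<^sub>R Js + sin t *\<^sub>R v))\<^sup>2 = 1" by (simp add: Js v)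
      then show ?thesis by (simp add: power2_eq_1_iff) (metis norm_ge_zero le_minus_one_simps(3) not_le)
    qed
    then have "2 * T * DV (fst ((0, v) + (0, 0))) = V * DT ((0, v) + (0, 0))"
      using qs by (intro direction[of "(0, Js)" "(qs, 0)"]) (auto simp: orientation_sphere_def)
    then show ?thesis
      using V has_derivative_linear[OF DV] by (simp add: TJ linear_0)
  qed
  \<comment> \<open>The component of \<open>inertia_inv qs *v Js\<close> orthogonal to
    \<open>Js\<close>. By \<open>orth\<close> it is also orthogonal to the whole vector, hence to
    itself.\<close>
  define w where "w = inertia_inv qs *v Js - (Js \<bullet> (inertia_inv qs *v Js)) *\<^sub>R Js"
  have wJ: "w \<bullet> Js = 0"
    using Js by (simp add: w_def inner_diff_right inner_commute norm_eq_1)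
  have "w = 0"
  proof (rule ccontr)
    assume "w \<noteq> 0"
    then have "(w /\<^sub>R norm w) \<bullet> (inertia_inv qs *v Js) = 0"
      using wJ by (intro orth) auto
    then have "w \<bullet> (inertia_inv qs *v Js) = 0" using \<open>w \<noteq> 0\<close> by simp
    then have "w \<bullet> w = 0"
      using wJ by (subst (2) w_def) (simp add: inner_diff_right)
    with \<open>w \<noteq> 0\<close> show False by simp
  qed
  then have NJ: "inertia_inv qs *v Js = (Js \<bullet> (inertia_inv qs *v Js)) *\<^sub>R Js"
    by (simp add: w_def)

  \<comment> \<open>The dilation direction forces \<open>\<mu>\<^sup>2 * T = - V\<close>. As
    \<open>T\<close> is positive, a positive solution exists exactly when \<open>V < 0\<close>,
    which \<open>attractive\<close> supplies.\<close>
  define \<mu> where "\<mu> = sqrt (- V / T)"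
  have \<mu>: "0 < \<mu>" "\<mu>\<^sup>2 = - V / T" using V T by (simp_all add: \<mu>_def divide_neg_pos order.strict_implies_order)
  define J where "J = \<mu> *\<^sub>R Js"
  have cross: "cross3 J (inertia_inv qs *v J) = 0"
    unfolding J_def by (subst matrix_vector_mult_scaleR, subst NJ) (simp add: cross_mult_left cross_mult_right)

  define D where "D = (\<lambda>v. 1/2 * (\<mu>\<^sup>2 * DT (v, 0)) + DV v)"
  have "((\<lambda>x. 1/2 * (\<mu>\<^sup>2 * inertia_form x Js) + potential m \<alpha> x) has_derivative D) (at qs)"
    unfolding D_def by (intro derivative_intros Tq DV)
  then have DW: "((\<lambda>x. 1/2 * inertia_form x J + potential m \<alpha> x) has_derivative D) (at qs)"
    by (simp add: J_def inertia_form_scaleR)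
  note linD = has_derivative_linear[OF DW]
  \<comment> \<open>For this \<open>\<mu>\<close>, \<open>D v\<close> equals
    \<open>(2 * T * DV v - V * DT (v, 0)) / (2 * T)\<close>.\<close>
  have tangential: "D v = 0" if "2 * T * DV v = V * DT (v, 0)" for v
    using that T by (simp add: D_def \<mu> field_simps)

  have "2 * T * DV (fst ((0, 0) + (axis 3 1, 0 :: real^3))) = V * DT ((0, 0) + (axis 3 1, 0))"
  proof (rule direction[of "(0, 0)" "(qs, Js)"])
    have "\<forall>\<^sub>F t in nhds 0. 0 < qs $ 3 + t \<and> qs $ 3 + t < pi"
      using qi by (intro eventually_conj order_tendstoD[of "\<lambda>t. qs $ 3 + t" "qs $ 3"])
        (auto simp: internal_space_interior_def intro!: tendsto_eq_intros filterlim_ident)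
    then show "\<forall>\<^sub>F t in nhds 0. cos t *\<^sub>R (0, 0) + sin t *\<^sub>R (0, 0) + t *\<^sub>R (axis 3 1, 0) + (qs, Js)
         \<in> shape_space \<times> orientation_sphere"
      by eventually_elim (use pos one Js in \<open>simp add: shape_space_def internal_space_interior_def
          orientation_sphere_def axis_def add.commute\<close>)
  qed simp
  then have D3: "D (axis 3 1) = 0" by (intro tangential) simp

  \<comment> \<open>\<open>a\<close> is radial and \<open>b\<close> tangent to the unit circle of
    lengths; with \<open>axis 3 1\<close> they form an orthonormal basis. Rotating \<open>a\<close>
    towards \<open>b\<close> stays on the circle and, for small times, keeps both lengths
    positive.\<close>
  define a b where "a = (vector [qs $ 1, qs $ 2, 0] :: real^3)"
    and "b = (vector [- qs $ 2, qs $ 1, 0] :: real^3)"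
  have "2 * T * DV (fst ((b, 0 :: real^3) + (0, 0))) = V * DT ((b, 0) + (0, 0))"
  proof (rule direction[of "(a, 0)" "(vector [0, 0, qs $ 3], Js)"])
    have "\<forall>\<^sub>F t in nhds 0. 0 < cos t * qs $ 1 - sin t * qs $ 2 \<and> 0 < cos t * qs $ 2 + sin t * qs $ 1"
      using pos by (intro eventually_conj order_tendstoD(1)[of _ "qs $ 1"] order_tendstoD(1)[of _ "qs $ 2"])
        (auto intro!: tendsto_eq_intros filterlim_ident)
    then show "\<forall>\<^sub>F t in nhds 0. cos t *\<^sub>R (a, 0) + sin t *\<^sub>R (b, 0) + t *\<^sub>R (0, 0)
           + (vector [0, 0, qs $ 3], Js) \<in> shape_space \<times> orientation_sphere"
    proof eventually_elim
      case (elim t)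
      have "(cos t * qs $ 1 - sin t * qs $ 2)\<^sup>2 + (cos t * qs $ 2 + sin t * qs $ 1)\<^sup>2
          = ((cos t)\<^sup>2 + (sin t)\<^sup>2) * ((qs $ 1)\<^sup>2 + (qs $ 2)\<^sup>2)"
        by algebra
      then have "(cos t * qs $ 1 - sin t * qs $ 2)\<^sup>2 + (cos t * qs $ 2 + sin t * qs $ 1)\<^sup>2 = 1"
        by (simp only: one sin_cos_squared_add2 mult_1)
      then show ?case
        using elim qi Js
        by (simp add: shape_space_def internal_space_interior_def orientation_sphere_def a_def b_def)
    qed
  qed (simp add: a_def vec_eq_iff forall_3)
  then have Db: "D b = 0" by (intro tangential) simp

  \<comment> \<open>The radial direction leaves the shape space, so criticality says nothing about
    it. Homogeneity replaces it: along dilations the effective potential is explicit in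
    \<open>t\<close>, and its derivative is taken at \<open>t = 1\<close>.\<close>
  have dil: "((\<lambda>t. dilation t qs) has_derivative (\<lambda>t. t *\<^sub>R a)) (at 1)"
  proof -
    have "(\<lambda>t. dilation t qs) = (\<lambda>t. t *\<^sub>R a + vector [0, 0, qs $ 3])"
      by (auto simp: dilation_def a_def vec_eq_iff forall_3)
    then show ?thesis by (auto intro!: derivative_eq_intros)
  qed
  have "dilation 1 qs = qs" by (simp add: dilation_def vec_eq_iff forall_3)
  then have "((\<lambda>t. 1/2 * inertia_form (dilation t qs) J + potential m \<alpha> (dilation t qs))
      has_derivative (\<lambda>t. D (t *\<^sub>R a))) (at 1)"
    by (intro has_derivative_compose[OF dil, of "\<lambda>x. 1/2 * inertia_form x J + potential m \<alpha> x"])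
      (use DW in simp)
  then have "((\<lambda>t. 1/2 * (\<mu>\<^sup>2 * T / t\<^sup>2) + V / t) has_derivative (\<lambda>t. D (t *\<^sub>R a))) (at 1)"
    by (rule has_derivative_transform_within_open[where s="{0<..}"])
      (auto simp: inertia_form_dilation potential_dilation J_def inertia_form_scaleR T_def V_def)
  moreover have "((\<lambda>t::real. 1/2 * (\<mu>\<^sup>2 * T / t\<^sup>2) + V / t) has_derivative
      (\<lambda>t. (- \<mu>\<^sup>2 * T - V) * t)) (at 1)"
    by (auto intro!: derivative_eq_intros simp: algebra_simps)
  ultimately have "D (1 *\<^sub>R a) = (- \<mu>\<^sup>2 * T - V) * 1"
    by (blast dest: has_derivative_unique fun_cong)
  then have Da: "D a = 0" using \<mu> T by simp

  have "D v = 0" for v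
  proof -
    \<comment> \<open>The coefficients are the inner products of \<open>v\<close> with the
      orthonormal basis.\<close>
    have "v = (v $ 1 * qs $ 1 + v $ 2 * qs $ 2) *\<^sub>R a + (v $ 2 * qs $ 1 - v $ 1 * qs $ 2) *\<^sub>R b
        + (v $ 3) *\<^sub>R axis 3 1"
    proof -
      have "(v $ 1 * qs $ 1 + v $ 2 * qs $ 2) * qs $ 1 - (v $ 2 * qs $ 1 - v $ 1 * qs $ 2) * qs $ 2 = v $ 1"
        "(v $ 1 * qs $ 1 + v $ 2 * qs $ 2) * qs $ 2 + (v $ 2 * qs $ 1 - v $ 1 * qs $ 2) * qs $ 1 = v $ 2"
        using one by algebra+
      then show ?thesis
        by (simp add: vec_eq_iff forall_3 a_def b_def axis_def)
    qed
    then have "D v = D ((v $ 1 * qs $ 1 + v $ 2 * qs $ 2) *\<^sub>R a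
        + (v $ 2 * qs $ 1 - v $ 1 * qs $ 2) *\<^sub>R b + (v $ 3) *\<^sub>R axis 3 1)"
      by (rule arg_cong)
    also have "\<dots> = 0"
      by (simp add: linear_add[OF linD] linear_scale[OF linD] Da Db D3)
    finally show ?thesis .
  qed
  then have "D = (\<lambda>_. 0)" by (rule ext)
  then have "((\<lambda>x. 1/2 * inertia_form x J + potential m \<alpha> x) has_derivative (\<lambda>_. 0)) (at qs)"
    using DW by (simp only:)
  from relative_equilibriumI[OF qi cross this]
  have "\<exists>p. noncollinear_relative_equilibrium m \<alpha> qs p J" by blast
  \<comment> \<open>All rescaling sits in \<open>J\<close>, so the dilation factor is 1, and
    positivity of \<open>\<mu>\<close> makes normalising \<open>J\<close> return
    \<open>Js\<close>.\<close>
  moreover have "is_shape_orientation_of (qs, Js) qs J"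
    using \<mu>(1) Js qs \<open>dilation 1 qs = qs\<close>
    by (auto simp: is_shape_orientation_of_def J_def intro!: exI[of _ 1])
  ultimately show ?thesis by blast
qed

end
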